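(* Let $\rho$ be the evaluation of palindromic polynomials defined in the context, and put $A_k=\rho(x^k)$, $B_k=\rho\bigl((1+x)x^k\bigr)$ for $k\ge0$. Let $a=(a_m)_{m\ge0}$ be the sequence interleaving $A$ and $B$, namely $a_{2k}=A_k$ and $a_{2k+1}=B_k$. For $N\ge1$ let $M_N$ be the $N\times N$ matrix with entries $M_N(i,j)=\rho\bigl(x^i(1+x)^j\bigr)\,2^{-\lfloor j/2\rfloor}$, $0\le i,j\le N-1$. Then $$\det M_N=2^{\tau_N}\,\det\bigl(a_{2i+j}\bigr)_{0\le i,j\le N-1}, \qquad \tau_N=\binom{\lceil N/2\rceil}{2}+\binom{\lfloor N/2\rfloor}{2}.$$
   Context: The index of a nonzero polynomial is its degree plus its valuation (the order of vanishing at $0$). A polynomial $P\in\mathbb Q[x]$ is palindromic of index $d$ if $x^dP(1/x)=P(x)$; e.g. $x^i(1+x)^j$ is palindromic of index $2i+j$. For $P$ palindromic of index $d$ put $$\mathscr N_0(P)=\frac{(x^{d}+1)\,P(1)-2P(x)}{(x-1)^2},$$ which is a polynomial, palindromic of index $d-2$ when nonzero (and $\mathscr N_0(0)=0$). Define $\rho(P)$ to be the constant term of $\mathscr N_0^{\lfloor d/2\rfloor}(P)$ (at each iteration $\mathscr N_0$ is formed with the current index); in particular $\rho(1)=1$ and $\rho(c(1+x))=c$. *)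

theory Defs
  imports
    "HOL-Computational_Algebra.Polynomial"
    "Jordan_Normal_Form.Determinant"
begin

text \<open>
  For nonzero \<open>P\<close>, \<open>order 0 P\<close> is the order of
  vanishing at \<open>0\<close>; the index of the zero polynomial is never relevant, since
  \<open>N0 0 = 0\<close> whatever the index is.
\<close>

definition pindex :: "rat poly \<Rightarrow> nat" where
  "pindex P = degree P + order 0 P"

definition palindromic :: "nat \<Rightarrow> rat poly \<Rightarrow> bool" where
  "palindromic d P \<longleftrightarrow> (\<forall>x. x \<noteq> 0 \<longrightarrow> x ^ d * poly P (1 / x) = poly P x)"

definition N0_num :: "rat poly \<Rightarrow> rat poly" where
  "N0_num P = smult (poly P 1) (monom 1 (pindex P) + 1) - smult 2 P"

text \<open>The division is exact for palindromic \<open>P\<close>, see \<open>N0_exact\<close> below.\<close>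

definition N0 :: "rat poly \<Rightarrow> rat poly" where
  "N0 P = N0_num P div [:-1, 1:] ^ 2"

definition rho :: "rat poly \<Rightarrow> rat" where
  "rho P = coeff ((N0 ^^ (pindex P div 2)) P) 0"

definition xpoly :: "rat poly" where
  "xpoly = [:0, 1:]"

definition A_seq :: "nat \<Rightarrow> rat" where
  "A_seq k = rho (xpoly ^ k)"

definition B_seq :: "nat \<Rightarrow> rat" where
  "B_seq k = rho ((1 + xpoly) * xpoly ^ k)"

definition a_seq :: "nat \<Rightarrow> rat" where
  "a_seq m = (if even m then A_seq (m div 2) else B_seq (m div 2))"

definition M_mat :: "nat \<Rightarrow> rat mat" where
  "M_mat N = mat N N (\<lambda>(i, j). rho (xpoly ^ i * (1 + xpoly) ^ j) / 2 ^ (j div 2))"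

text \<open>\<open>(N + 1) div 2\<close> is the ceiling of \<open>N / 2\<close>.\<close>

definition tau :: "nat \<Rightarrow> nat" where
  "tau N = ((N + 1) div 2 choose 2) + (N div 2 choose 2)"


lemma poly_eq_nz:
  fixes p q :: "rat poly"
  assumes "\<And>x. x \<noteq> 0 \<Longrightarrow> poly p x = poly q x"
  shows "p = q"
proof -
  have "poly ([:0, 1:] * p) x = poly ([:0, 1:] * q) x" for x
    using assms[of x] by (cases "x = 0") auto
  hence "[:0, 1:] * p = [:0, 1:] * q"
    using poly_eq_poly_eq_iff by blast
  thus ?thesis by simp
qed

lemma palindromic_pindex:
  assumes "palindromic d P" "P \<noteq> 0"
  shows "pindex P = d"
proof -
  obtain Q where Q: "P = [:0, 1:] ^ order 0 P * Q" "\<not> [:0, 1:] dvd Q"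
    using order_decomp[OF assms(2), of 0] by auto
  have Q0: "Q \<noteq> 0" "coeff Q 0 \<noteq> 0"
    using Q(2) by (auto simp: poly_eq_0_iff_dvd[of Q 0, simplified, symmetric] poly_0_coeff_0)
  let ?v = "order 0 P"
  have deg: "degree P = ?v + degree Q"
    by (subst Q(1), subst degree_mult_eq) (use Q0 in \<open>auto simp: degree_power_eq\<close>)
  have "[:0, 1:] ^ d * reflect_poly Q = [:0, 1:] ^ (?v + degree P) * Q"
  proof (rule poly_eq_nz)
    fix x :: rat assume x: "x \<noteq> 0"
    have PQ: "poly P y = y ^ ?v * poly Q y" for y by (subst Q(1)) (simp add: poly_power)
    have "x ^ d * poly P (1 / x) = poly P x" using assms(1) x by (auto simp: palindromic_def)
    hence "x ^ d * poly Q (1 / x) = x ^ (?v + ?v) * poly Q x"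
      using x by (simp add: PQ power_add field_simps)
    thus "poly ([:0, 1:] ^ d * reflect_poly Q) x = poly ([:0, 1:] ^ (?v + degree P) * Q) x"
      using x by (simp add: poly_power poly_reflect_poly_nz deg power_add inverse_eq_divide algebra_simps)
  qed
  hence "degree ([:0, 1:] ^ d * reflect_poly Q) = degree ([:0, 1:] ^ (?v + degree P) * Q)" by simp
  hence "d + degree Q = ?v + degree P + degree Q"
    using Q0 by (subst (asm) (1 2) degree_mult_eq) (auto simp: degree_power_eq degree_reflect_poly_eq)
  thus ?thesis by (simp add: pindex_def)
qed

lemma N0_exact:
  assumes "palindromic d P"
  shows "N0 P * [:-1, 1:] ^ 2 = N0_num P"
proof (cases "P = 0")
  case False
  let ?f = "\<lambda>i. smult (coeff P i) ((monom 1 i - 1) * (monom 1 (d - i) - 1))"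
  have d: "pindex P = d" using palindromic_pindex[OF assms False] .
  hence le: "degree P \<le> d" by (simp add: pindex_def)
  have dv: "[:-1, 1:] dvd (monom 1 i - 1 :: rat poly)" for i
    using poly_eq_0_iff_dvd[of "monom 1 i - 1 :: rat poly" 1] by (simp add: poly_monom)
  have "[:-1, 1:] ^ 2 dvd (\<Sum>i\<le>degree P. ?f i)"
    unfolding power2_eq_square by (intro dvd_sum dvd_smult mult_dvd_mono dv)
  also have "(\<Sum>i\<le>degree P. ?f i) = N0_num P"
  proof (rule poly_eq_nz)
    fix x :: rat assume x: "x \<noteq> 0"
    have "x ^ d * poly P (1 / x) = poly P x" using assms x by (auto simp: palindromic_def)
    moreover have "x ^ d * poly P (1 / x) = (\<Sum>i\<le>degree P. coeff P i * x ^ (d - i))"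
      unfolding poly_altdef sum_distrib_left
      using x le by (intro sum.cong) (auto simp: power_diff field_simps)
    ultimately have e: "(\<Sum>i\<le>degree P. coeff P i * x ^ (d - i)) = poly P x" by simp
    have "poly (\<Sum>i\<le>degree P. ?f i) x
        = (\<Sum>i\<le>degree P. coeff P i * (x ^ d + 1) - coeff P i * x ^ i - coeff P i * x ^ (d - i))"
      unfolding poly_sum using le
      by (intro sum.cong) (auto simp: poly_monom algebra_simps simp flip: power_add)
    also have "\<dots> = poly P 1 * (x ^ d + 1) - poly P x - poly P x"
      unfolding sum_subtractf e by (simp add: poly_altdef sum_distrib_right)
    finally show "poly (\<Sum>i\<le>degree P. ?f i) x = poly (N0_num P) x"
      by (simp add: N0_num_def d poly_monom)
  qed
  finally show ?thesis by (simp add: N0_def)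
qed (simp add: N0_def N0_num_def)

lemma palindromic_basic: "palindromic (2 * i + j) (xpoly ^ i * (1 + xpoly) ^ j)"
proof (unfold palindromic_def, intro allI impI)
  fix x :: rat assume x: "x \<noteq> 0"
  have "x ^ j * (1 + 1 / x) ^ j = (1 + x) ^ j"
    using x by (simp add: field_simps flip: power_mult_distrib)
  moreover have "x ^ (2 * i) * (1 / x) ^ i = x ^ i"
    using x by (simp add: mult_2 power_add power_one_over)
  ultimately have "(x ^ (2 * i) * (1 / x) ^ i) * (x ^ j * (1 + 1 / x) ^ j) = x ^ i * (1 + x) ^ j"
    by simp
  thus "x ^ (2 * i + j) * poly (xpoly ^ i * (1 + xpoly) ^ j) (1 / x) =
      poly (xpoly ^ i * (1 + xpoly) ^ j) x"
    by (simp add: xpoly_def poly_power power_add mult_ac)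
qed

end

theory Submission
  imports Defs
begin

text \<open>
  Multiplying a palindromic \<open>P\<close> of index \<open>d\<close> by \<open>(1 + x)\<^sup>2 = 4 x + (x - 1)\<^sup>2\<close> gives
  \<open>N0 ((1 + x)\<^sup>2 P) = 4 N0 (x P) - 2 P\<close>, and \<open>\<rho>\<close> is linear on the palindromic polynomials of
  a fixed index; hence \<open>\<rho> ((1 + x)\<^sup>2 P) = 4 \<rho> (x P) - 2 \<rho> P\<close>.  So, after normalisation, column
  \<open>j + 2\<close> of \<open>M\<^sub>N\<close> is obtained from column \<open>j\<close> by the operator \<open>2 E - 1\<close>, where \<open>E\<close> shifts the row
  index.  Since \<open>E\<close> shifts the index of \<open>a\<close> by two, \<open>M\<^sub>N\<close> factors as \<open>(a\<^bsub>2i+j\<^esub>) U\<close>, where column \<open>j\<close>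
  of the upper triangular matrix \<open>U\<close> lists the coefficients of
  \<open>y\<^bsup>j mod 2\<^esup> (2 y\<^sup>2 - 1)\<^bsup>j div 2\<^esup>\<close>.
\<close>

lemma palindromicD: "palindromic d P \<Longrightarrow> x \<noteq> 0 \<Longrightarrow> x ^ d * poly P (1 / x) = poly P x"
  by (simp add: palindromic_def)

lemma palindromic_add: "palindromic d P \<Longrightarrow> palindromic d Q \<Longrightarrow> palindromic d (P + Q)"
  by (simp add: palindromic_def distrib_left)

lemma palindromic_smult: "palindromic d P \<Longrightarrow> palindromic d (smult c P)"
  by (simp add: palindromic_def mult.left_commute)

lemma palindromic_mult:
  assumes "palindromic d P" "palindromic e Q"
  shows "palindromic (d + e) (P * Q)"
  unfolding palindromic_def
proof (intro allI impI)
  fix x :: rat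
  assume "x \<noteq> 0"
  then have "(x ^ d * poly P (1 / x)) * (x ^ e * poly Q (1 / x)) = poly P x * poly Q x"
    using assms by (simp add: palindromicD)
  then show "x ^ (d + e) * poly (P * Q) (1 / x) = poly (P * Q) x"
    by (simp add: power_add mult_ac)
qed

text \<open>This also covers \<open>P = 0\<close>, where \<open>pindex P\<close> need not be \<open>d\<close>.\<close>

lemma N0_num_palindromic:
  assumes "palindromic d P"
  shows "N0_num P = smult (poly P 1) (monom 1 d + 1) - smult 2 P"
  using palindromic_pindex[OF assms] by (cases "P = 0") (auto simp: N0_num_def)

text \<open>The factor \<open>[:-1, 1:] ^ 2\<close> is nonzero and so cancels; the
  \<open>div\<close> in \<open>N0\<close> never has to be computed.\<close>

lemma N0_eqI:
  assumes "palindromic d P"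
    and "Q * [:-1, 1:] ^ 2 = smult (poly P 1) (monom 1 d + 1) - smult 2 P"
  shows "N0 P = Q"
proof -
  have "N0 P * [:-1, 1:] ^ 2 = Q * [:-1, 1:] ^ 2"
    using N0_exact[OF assms(1)] assms N0_num_palindromic by simp
  then show ?thesis by simp
qed

lemma N0_mult:
  assumes "palindromic d P"
  shows "N0 P * [:-1, 1:] ^ 2 = smult (poly P 1) (monom 1 d + 1) - smult 2 P"
  using N0_exact[OF assms] N0_num_palindromic[OF assms] by simp

lemma palindromic_N0:
  assumes "palindromic (d + 2) P"
  shows "palindromic d (N0 P)"
  unfolding palindromic_def
proof (intro allI impI)
  fix x :: rat
  assume x: "x \<noteq> 0"
  have N: "poly (N0 P) y * (y - 1) ^ 2 = poly P 1 * (y ^ (d + 2) + 1) - 2 * poly P y" for y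
    using arg_cong[OF N0_mult[OF assms], of "\<lambda>p. poly p y"]
    by (simp add: poly_power poly_monom algebra_simps)
  show "x ^ d * poly (N0 P) (1 / x) = poly (N0 P) x"
  \<comment> \<open>At \<open>x = 1\<close> the factor \<open>(x - 1)\<^sup>2\<close> cannot be
    cancelled, but there the claim is trivial.\<close>
  proof (cases "x = 1")
    case False
    have sq: "x\<^sup>2 * (1 / x - 1)\<^sup>2 = (x - 1)\<^sup>2"
      using x by (simp add: right_diff_distrib flip: power_mult_distrib)
        (simp add: power2_commute)
    have "(x ^ d * poly (N0 P) (1 / x)) * (x - 1)\<^sup>2
        = x ^ (d + 2) * (poly (N0 P) (1 / x) * (1 / x - 1)\<^sup>2)"
      unfolding sq[symmetric] by (simp only: power_add mult_ac)
    also have "\<dots> = poly P 1 * (x ^ (d + 2) * ((1 / x) ^ (d + 2) + 1))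
        - 2 * (x ^ (d + 2) * poly P (1 / x))"
      unfolding N by (simp add: algebra_simps)
    also have "\<dots> = poly P 1 * (x ^ (d + 2) + 1) - 2 * poly P x"
      unfolding palindromicD[OF assms x] using x
      by (simp add: distrib_left power_one_over add.commute del: power_Suc)
    also have "\<dots> = poly (N0 P) x * (x - 1)\<^sup>2"
      by (rule N[symmetric])
    finally show ?thesis
      using False by simp
  qed simp
qed

lemma N0_linear:
  assumes "palindromic d P" "palindromic d Q"
  shows "N0 (smult a P + smult b Q) = smult a (N0 P) + smult b (N0 Q)"
proof (rule N0_eqI)
  show "palindromic d (smult a P + smult b Q)"
    by (intro palindromic_add palindromic_smult assms)
  show "(smult a (N0 P) + smult b (N0 Q)) * [:-1, 1:] ^ 2 =
      smult (poly (smult a P + smult b Q) 1) (monom 1 d + 1) - smult 2 (smult a P + smult b Q)"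
    unfolding distrib_right mult_smult_left N0_mult[OF assms(1)] N0_mult[OF assms(2)]
    by (simp add: smult_diff_right smult_add_right smult_add_left mult.commute)
qed

text \<open>Each application lowers the common index by 2; the bound on \<open>n\<close> keeps the
  index from running below 0.\<close>

lemma N0_funpow_linear:
  assumes "palindromic d P" "palindromic d Q" "2 * n \<le> d"
  shows "(N0 ^^ n) (smult a P + smult b Q) = smult a ((N0 ^^ n) P) + smult b ((N0 ^^ n) Q)"
  using assms
proof (induction n arbitrary: d P Q)
  case (Suc n)
  define e where "e = d - 2"
  then have e: "d = e + 2" "2 * n \<le> e"
    using Suc.prems(3) by auto
  show ?case
    unfolding funpow_Suc_right o_apply N0_linear[OF Suc.prems(1,2)]
    by (intro Suc.IH[of e] palindromic_N0) (use Suc.prems e in auto)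
qed simp

text \<open>Replaces \<open>pindex P\<close> by the known index, also when a linear combination
  happens to vanish.\<close>

lemma rho_palindromic:
  assumes "palindromic d P"
  shows "rho P = coeff ((N0 ^^ (d div 2)) P) 0"
proof (cases "P = 0")
  case True
  have "(N0 ^^ n) 0 = 0" for n
    by (induction n) (simp_all add: N0_def N0_num_def)
  then show ?thesis
    by (simp add: True rho_def)
qed (simp add: rho_def palindromic_pindex[OF assms])

lemma palindromic_xpoly: "palindromic 2 xpoly"
  using palindromic_basic[of 1 0] by simp

lemma palindromic_one_plus_xpoly_sq: "palindromic 2 ((1 + xpoly) ^ 2)"
  using palindromic_basic[of 0 2] by (simp add: numeral_2_eq_2)

lemma N0_times_one_plus_xpoly_sq:
  assumes "palindromic d P"
  shows "N0 (P * (1 + xpoly) ^ 2) = smult 4 (N0 (P * xpoly)) + smult (-2) P"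
proof (rule N0_eqI)
  show "palindromic (d + 2) (P * (1 + xpoly) ^ 2)"
    by (intro palindromic_mult assms palindromic_one_plus_xpoly_sq)
  have "palindromic (d + 2) (P * xpoly)"
    by (intro palindromic_mult assms palindromic_xpoly)
  from N0_mult[OF this]
  have N: "N0 (P * xpoly) * [:-1, 1:] ^ 2
      = smult (poly P 1) (monom 1 (d + 2) + 1) - smult 2 (P * xpoly)"
    by (simp add: xpoly_def)
  have sq: "(1 + xpoly) ^ 2 = smult 4 xpoly + [:-1, 1:] ^ 2"
    by (simp add: xpoly_def power2_eq_square one_pCons)
  \<comment> \<open>By this factor 4 the multiples of \<open>monom 1 (d + 2) + 1\<close> on the two
    sides agree.\<close>
  have v: "poly (P * (1 + xpoly) ^ 2) 1 = 4 * poly P 1"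
    by (simp add: xpoly_def)
  show "(smult 4 (N0 (P * xpoly)) + smult (-2) P) * [:-1, 1:] ^ 2 =
      smult (poly (P * (1 + xpoly) ^ 2) 1) (monom 1 (d + 2) + 1)
        - smult 2 (P * (1 + xpoly) ^ 2)"
    unfolding v unfolding sq distrib_right distrib_left mult_smult_left mult_smult_right N
    by (simp add: smult_diff_right smult_add_right)
qed

text \<open>After one \<open>N0\<close> the index is \<open>d\<close>, so the remaining
  \<open>d div 2\<close> iterations are exactly those that define \<open>rho P\<close>.\<close>

lemma rho_times_one_plus_xpoly_sq:
  assumes "palindromic d P"
  shows "rho (P * (1 + xpoly) ^ 2) = 4 * rho (P * xpoly) - 2 * rho P"
proof -
  have px: "palindromic (d + 2) (P * xpoly)"
    by (intro palindromic_mult assms palindromic_xpoly)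
  have "palindromic (d + 2) (P * (1 + xpoly) ^ 2)"
    by (intro palindromic_mult assms palindromic_one_plus_xpoly_sq)
  then have "rho (P * (1 + xpoly) ^ 2)
      = coeff ((N0 ^^ (d div 2)) (smult 4 (N0 (P * xpoly)) + smult (-2) P)) 0"
    by (simp add: rho_palindromic funpow_Suc_right N0_times_one_plus_xpoly_sq[OF assms]
        del: funpow.simps)
  also have "\<dots> = 4 * coeff ((N0 ^^ (d div 2)) (N0 (P * xpoly))) 0
      - 2 * coeff ((N0 ^^ (d div 2)) P) 0"
    by (subst N0_funpow_linear[OF palindromic_N0[OF px] assms]) auto
  finally show ?thesis
    by (simp add: rho_palindromic[OF px] rho_palindromic[OF assms] funpow_Suc_right
        del: funpow.simps)
qed

text \<open>The recursion in steps of two mirrors that of \<open>rho\<close> in the exponent of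
  \<open>1 + xpoly\<close>, so one induction rule serves both.\<close>

fun col_poly :: "nat \<Rightarrow> rat poly" where
  "col_poly 0 = 1"
| "col_poly (Suc 0) = monom 1 1"
| "col_poly (Suc (Suc j)) = smult 2 (monom 1 2 * col_poly j) - col_poly j"

lemma coeff_col_poly_gt: "j < l \<Longrightarrow> coeff (col_poly j) l = 0"
  by (induction j arbitrary: l rule: col_poly.induct) (auto simp: coeff_monom_mult)

lemma coeff_col_poly_diag: "coeff (col_poly j) j = 2 ^ (j div 2)"
  by (induction j rule: col_poly.induct) (auto simp: coeff_monom_mult coeff_col_poly_gt)

lemma sum_coeff_col_poly_extend:
  assumes "j < n"
  shows "(\<Sum>l<n. coeff (col_poly j) l * f l) = (\<Sum>l\<le>j. coeff (col_poly j) l * f l)"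
  using assms by (intro sum.mono_neutral_right) (auto simp: coeff_col_poly_gt)

text \<open>Under the linear functional sending the \<open>l\<close>-th power of the variable to
  \<open>f l\<close>, multiplication by \<open>monom 1 2\<close> becomes a shift of \<open>f\<close>
  by two.\<close>

lemma sum_coeff_col_poly_Suc_Suc:
  fixes f :: "nat \<Rightarrow> rat"
  shows "(\<Sum>l\<le>Suc (Suc j). coeff (col_poly (Suc (Suc j))) l * f l)
    = 2 * (\<Sum>l\<le>j. coeff (col_poly j) l * f (l + 2)) - (\<Sum>l\<le>j. coeff (col_poly j) l * f l)"
proof -
  have "(\<Sum>l\<le>Suc (Suc j). coeff (col_poly (Suc (Suc j))) l * f l)
      = 2 * (\<Sum>l\<le>Suc (Suc j). coeff (monom 1 2 * col_poly j) l * f l)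
        - (\<Sum>l\<le>Suc (Suc j). coeff (col_poly j) l * f l)"
    by (simp only: col_poly.simps coeff_diff coeff_smult left_diff_distrib sum_subtractf
        sum_distrib_left mult.assoc)
  also have "(\<Sum>l\<le>Suc (Suc j). coeff (monom 1 2 * col_poly j) l * f l)
      = (\<Sum>l\<le>j. coeff (col_poly j) l * f (l + 2))"
    by (simp add: sum.atMost_Suc_shift coeff_monom_mult del: sum.atMost_Suc)
  also have "(\<Sum>l\<le>Suc (Suc j). coeff (col_poly j) l * f l) = (\<Sum>l\<le>j. coeff (col_poly j) l * f l)"
    by (simp add: coeff_col_poly_gt)
  finally show ?thesis .
qed

text \<open>The recurrence raises \<open>i\<close> by one, which moves \<open>2 * i + l\<close> by
  two; hence the induction on \<open>j\<close> keeps \<open>i\<close> arbitrary.\<close>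

lemma rho_eq_sum_a_seq:
  "rho (xpoly ^ i * (1 + xpoly) ^ j) / 2 ^ (j div 2)
    = (\<Sum>l\<le>j. coeff (col_poly j) l * a_seq (2 * i + l))"
proof (induction j arbitrary: i rule: col_poly.induct)
  case 1
  show ?case by (simp add: a_seq_def A_seq_def)
next
  case 2
  show ?case by (simp add: a_seq_def B_seq_def mult.commute)
next
  case (3 j)
  have "rho (xpoly ^ i * (1 + xpoly) ^ Suc (Suc j))
      = 4 * rho (xpoly ^ Suc i * (1 + xpoly) ^ j) - 2 * rho (xpoly ^ i * (1 + xpoly) ^ j)"
    using rho_times_one_plus_xpoly_sq[OF palindromic_basic[of i j]]
    by (simp add: power2_eq_square mult_ac)
  \<comment> \<open>The one extra factor 2 in the denominator turns the coefficients 4 and -2 into 2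
    and -1.\<close>
  then have "rho (xpoly ^ i * (1 + xpoly) ^ Suc (Suc j)) / 2 ^ (Suc (Suc j) div 2)
      = 2 * (rho (xpoly ^ Suc i * (1 + xpoly) ^ j) / 2 ^ (j div 2))
        - rho (xpoly ^ i * (1 + xpoly) ^ j) / 2 ^ (j div 2)"
    by (simp add: diff_divide_distrib del: power_Suc) (simp add: field_simps)
  also have "\<dots> = (\<Sum>l\<le>Suc (Suc j). coeff (col_poly (Suc (Suc j))) l * a_seq (2 * i + l))"
    unfolding 3 sum_coeff_col_poly_Suc_Suc by (simp add: add_ac)
  finally show ?case .
qed

text \<open>From \<open>N\<close> to \<open>Suc N\<close> the old ceiling becomes the new floor, and
  the old floor plus one the new ceiling; Pascal's rule gives the increment
  \<open>N div 2\<close>.\<close>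

lemma sum_div_2_eq_tau: "(\<Sum>j<N. j div 2) = tau N"
proof (induction N)
  case (Suc N)
  have "Suc m choose 2 = (m choose 2) + m" for m
    by (simp add: numeral_2_eq_2)
  then have "tau (Suc N) = tau N + N div 2"
    by (simp add: tau_def)
  with Suc show ?case by simp
qed (simp add: tau_def)

theorem theorem26p3:
  fixes N :: nat
  assumes "N \<ge> 1"
  shows "det (M_mat N) = 2 ^ tau N * det (mat N N (\<lambda>(i, j). a_seq (2 * i + j)))"
proof -
  define H where "H = mat N N (\<lambda>(i, j). a_seq (2 * i + j))"
  define U where "U = mat N N (\<lambda>(l, j). coeff (col_poly j) l)"
  have carrier: "H \<in> carrier_mat N N" "U \<in> carrier_mat N N"
    by (auto simp: H_def U_def)
  have "M_mat N = H * U"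
  proof (rule eq_matI)
    fix i j assume "i < dim_row (H * U)" "j < dim_col (H * U)"
    then have ij: "i < N" "j < N" by (simp_all add: H_def U_def)
    then have "(H * U) $$ (i, j) = (\<Sum>l<N. coeff (col_poly j) l * a_seq (2 * i + l))"
      by (simp add: H_def U_def scalar_prod_def atLeast0LessThan mult.commute)
    with ij show "M_mat N $$ (i, j) = (H * U) $$ (i, j)"
      by (simp add: M_mat_def rho_eq_sum_a_seq sum_coeff_col_poly_extend)
  qed (simp_all add: M_mat_def H_def U_def)
  then have "det (M_mat N) = det H * det U"
    by (simp add: det_mult[OF carrier])
  also have "det U = (\<Prod>j<N. 2 ^ (j div 2))"
  proof -
    have "upper_triangular U"
      by (auto simp: upper_triangular_def U_def coeff_col_poly_gt)
    then have "det U = (\<Prod>j<N. U $$ (j, j))"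
      using carrier
      by (simp add: det_upper_triangular prod_list_diag_prod atLeast0LessThan)
    then show ?thesis
      by (simp add: U_def coeff_col_poly_diag)
  qed
  also have "\<dots> = 2 ^ tau N"
    by (simp add: sum_div_2_eq_tau flip: power_sum)
  finally show ?thesis
    by (simp add: H_def)
qed

end
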